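(* Let $P$ be a finite poset with $|P|=n$, and let $\mathcal{L}=\mathcal{J}(P)$ be the distributive lattice of poset ideals of $P$. Then $$|\{(p,q): p,q\in P,\ p\le q\}|=\frac{1}{2}\sum_{i\ge 0}(-1)^{i+1}b_i(\mathcal{L})(n+i)^2.$$
   Context: A poset ideal of a finite poset $P$ is a subset $I\subset P$ such that $x\in I$, $y\in P$, $y\le x$ imply $y\in I$ ($\emptyset$ and $P$ are poset ideals). $\mathcal{J}(P)$ is the set of all poset ideals of $P$, ordered by inclusion; it is a finite distributive lattice. The Boolean lattice of rank $i$ is the lattice of all subsets of $\{1,\dots,i\}$ ordered by inclusion. For $I\le J$ in $\mathcal{L}$, the interval $[I,J]$ is $\{M\in\mathcal{L}: I\le M\le J\}$ with the induced order; $b_i(\mathcal{L})$ is the number of intervals of $\mathcal{L}$ that are isomorphic to the Boolean lattice of rank $i$ (so $b_0(\mathcal{L})=|\mathcal{L}|$). *)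

theory Defs
  imports Complex_Main
begin

definition poset_ideals :: "'a set \<Rightarrow> 'a rel \<Rightarrow> 'a set set" where
  "poset_ideals P r = {I. I \<subseteq> P \<and> (\<forall>x\<in>I. \<forall>y\<in>P. (y, x) \<in> r \<longrightarrow> y \<in> I)}"

definition order_isomorphic :: "'a::order set \<Rightarrow> 'b::order set \<Rightarrow> bool" where
  "order_isomorphic A B \<longleftrightarrow>
     (\<exists>f. bij_betw f A B \<and> (\<forall>x\<in>A. \<forall>y\<in>A. x \<le> y \<longleftrightarrow> f x \<le> f y))"

definition boolean_lattice :: "nat \<Rightarrow> nat set set" where
  "boolean_lattice i = Pow {1..i}"

definition interval_in :: "'a::order set \<Rightarrow> 'a \<Rightarrow> 'a \<Rightarrow> 'a set" where
  "interval_in L I J = {M \<in> L. I \<le> M \<and> M \<le> J}"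

text \<open>An interval \<open>[I, J]\<close> with \<open>I \<le> J\<close> is a set whose least and greatest elements
  are \<open>I\<close> and \<open>J\<close>, so counting the sets below is the same as counting pairs \<open>(I, J)\<close>.\<close>

definition boolean_intervals :: "'a::order set \<Rightarrow> nat \<Rightarrow> 'a set set" where
  "boolean_intervals L i = {interval_in L I J | I J.
     I \<in> L \<and> J \<in> L \<and> I \<le> J \<and> order_isomorphic (interval_in L I J) (boolean_lattice i)}"

definition num_boolean_intervals :: "'a::order set \<Rightarrow> nat \<Rightarrow> nat" where
  "num_boolean_intervals L i = card (boolean_intervals L i)"

text \<open>For finite \<open>L\<close> only finitely many of these numbers are nonzero, so a series weighted
  by them is a finite sum.\<close>

lemma num_boolean_intervals_eq_0:
  assumes "finite L" and "card L < 2 ^ i"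
  shows "num_boolean_intervals L i = 0"
proof -
  have "\<not> order_isomorphic (interval_in L I J) (boolean_lattice i)" for I J
  proof
    assume "order_isomorphic (interval_in L I J) (boolean_lattice i)"
    then have "card (interval_in L I J) = 2 ^ i"
      by (auto simp: order_isomorphic_def boolean_lattice_def card_Pow dest: bij_betw_same_card)
    moreover have "card (interval_in L I J) \<le> card L"
      using assms(1) by (intro card_mono) (auto simp: interval_in_def)
    ultimately show False using assms(2) by simp
  qed
  then show ?thesis by (simp add: num_boolean_intervals_def boolean_intervals_def)
qed

lemma summable_num_boolean_intervals:
  fixes c :: "nat \<Rightarrow> real"
  assumes "finite L"
  shows "summable (\<lambda>i. c i * real (num_boolean_intervals L i) * d i)"
proof (rule summable_finite)
  show "finite {..card L}" by simp
  show "c i * real (num_boolean_intervals L i) * d i = 0" if "i \<notin> {..card L}" for i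
  proof -
    have "card L < 2 ^ i" using that by (meson atMost_iff less_exp less_trans not_le)
    then show ?thesis using num_boolean_intervals_eq_0[OF assms] by simp
  qed
qed

end

theory Submission
  imports Defs
begin

text \<open>Sending a poset ideal to its set of maximal elements identifies ideals with antichains,
  and an interval \<open>[I, J]\<close> is Boolean of rank \<open>i\<close> exactly when \<open>J - I\<close> consists of \<open>i\<close> maximal
  elements of \<open>J\<close>. Hence \<open>b\<^sub>i\<close> is the sum of \<open>|A| choose i\<close> over all antichains \<open>A\<close>, and the
  alternating sum becomes a sum over antichains of \<open>|A|\<close>-fold finite differences of the quadratic
  \<open>(n + i)\<^sup>2\<close>. These vanish for \<open>|A| > 2\<close>, so only the empty antichain, the \<open>n\<close> singletons and
  the incomparable pairs contribute.\<close>

section \<open>Finite differences of a quadratic\<close>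

text \<open>Pascal's rule: up to sign the sum is a \<open>k\<close>-th finite difference of
  \<open>f\<close> at 0, and one more difference subtracts the same sum for the shifted
  function.\<close>

lemma alternating_binomial_sum_Suc:
  fixes f :: "nat \<Rightarrow> 'a::comm_ring_1"
  shows "(\<Sum>i\<le>Suc k. (- 1) ^ i * of_nat (Suc k choose i) * f i) =
    (\<Sum>i\<le>k. (- 1) ^ i * of_nat (k choose i) * f i) -
    (\<Sum>i\<le>k. (- 1) ^ i * of_nat (k choose i) * f (Suc i))"
proof -
  \<comment> \<open>The added term has \<open>k choose Suc k\<close>, which is 0; with it the index
    shift yields exactly the \<open>k choose Suc i\<close> half of Pascal's rule.\<close>
  have "(\<Sum>i\<le>k. (- 1) ^ i * of_nat (k choose i) * f i) =
      (\<Sum>i\<le>Suc k. (- 1) ^ i * of_nat (k choose i) * f i)"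
    by (simp add: binomial_eq_0)
  also have "\<dots> = f 0 + (\<Sum>i\<le>k. (- 1) ^ Suc i * of_nat (k choose Suc i) * f (Suc i))"
    by (subst sum.atMost_Suc_shift) simp
  finally have "(\<Sum>i\<le>k. (- 1) ^ Suc i * of_nat (k choose Suc i) * f (Suc i)) =
      (\<Sum>i\<le>k. (- 1) ^ i * of_nat (k choose i) * f i) - f 0"
    by (simp add: algebra_simps)
  moreover have "(\<Sum>i\<le>k. (- 1) ^ Suc i * of_nat (Suc k choose Suc i) * f (Suc i)) =
      (\<Sum>i\<le>k. (- 1) ^ Suc i * of_nat (k choose Suc i) * f (Suc i)) -
      (\<Sum>i\<le>k. (- 1) ^ i * of_nat (k choose i) * f (Suc i))"
    unfolding sum_subtractf[symmetric] by (intro sum.cong refl) (simp add: algebra_simps)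
  ultimately show ?thesis
    by (subst sum.atMost_Suc_shift) simp
qed

text \<open>Induction with \<open>x\<close> arbitrary, because shifting the index replaces
  \<open>x\<close> by \<open>x + 1\<close>. Each difference lowers the degree by one, so nothing
  remains from the third on.\<close>

lemma alternating_binomial_sum_square:
  fixes x :: "'a::comm_ring_1"
  shows "(\<Sum>i\<le>k. (- 1) ^ i * of_nat (k choose i) * (x + of_nat i)\<^sup>2) =
    (if k = 0 then x\<^sup>2 else if k = 1 then - (2 * x + 1) else if k = 2 then 2 else 0)"
proof (induction k arbitrary: x)
  case (Suc k)
  have "(\<Sum>i\<le>k. (- 1) ^ i * of_nat (k choose i) * (x + of_nat (Suc i))\<^sup>2) =
      (\<Sum>i\<le>k. (- 1) ^ i * of_nat (k choose i) * ((x + 1) + of_nat i)\<^sup>2)"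
    by (simp add: algebra_simps)
  then show ?case
    unfolding alternating_binomial_sum_Suc Suc
    by (simp add: power2_eq_square algebra_simps)
qed simp

section \<open>Ideals, antichains and maximal elements\<close>

locale finite_poset =
  fixes P :: "'a set" and r :: "'a rel"
  assumes finite_P: "finite P" and partial_order: "partial_order_on P r"
begin

lemma le_refl: "x \<in> P \<Longrightarrow> (x, x) \<in> r"
  using partial_order by (auto simp: partial_order_on_def preorder_on_def refl_on_def)

lemma le_trans: "(x, y) \<in> r \<Longrightarrow> (y, z) \<in> r \<Longrightarrow> (x, z) \<in> r"
  using partial_order by (auto simp: partial_order_on_def preorder_on_def dest: transD)

lemma le_antisym: "(x, y) \<in> r \<Longrightarrow> (y, x) \<in> r \<Longrightarrow> x = y"
  using partial_order by (auto simp: partial_order_on_def dest: antisymD)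

definition antichain :: "'a set \<Rightarrow> bool" where
  "antichain A \<longleftrightarrow> A \<subseteq> P \<and> (\<forall>x\<in>A. \<forall>y\<in>A. (x, y) \<in> r \<longrightarrow> x = y)"

definition downset :: "'a set \<Rightarrow> 'a set" where
  "downset A = {y \<in> P. \<exists>x\<in>A. (y, x) \<in> r}"

definition maximals :: "'a set \<Rightarrow> 'a set" where
  "maximals J = {x \<in> J. \<forall>y\<in>J. (x, y) \<in> r \<longrightarrow> x = y}"

abbreviation ideals :: "'a set set" where
  "ideals \<equiv> poset_ideals P r"

lemma ideal_subset: "I \<in> ideals \<Longrightarrow> I \<subseteq> P"
  by (simp add: poset_ideals_def)

lemma ideal_down: "I \<in> ideals \<Longrightarrow> x \<in> I \<Longrightarrow> (y, x) \<in> r \<Longrightarrow> y \<in> P \<Longrightarrow> y \<in> I"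
  by (auto simp: poset_ideals_def)

lemma ideal_Int: "I \<in> ideals \<Longrightarrow> J \<in> ideals \<Longrightarrow> I \<inter> J \<in> ideals"
  by (auto simp: poset_ideals_def)

lemma ideal_Un: "I \<in> ideals \<Longrightarrow> J \<in> ideals \<Longrightarrow> I \<union> J \<in> ideals"
  by (auto simp: poset_ideals_def)

lemma ideal_downset: "downset A \<in> ideals"
  unfolding poset_ideals_def downset_def using le_trans by blast

lemma finite_ideals: "finite ideals"
  by (rule finite_subset[of _ "Pow P"]) (auto simp: poset_ideals_def finite_P)

lemma antichain_maximals: "J \<in> ideals \<Longrightarrow> antichain (maximals J)"
  using ideal_subset[of J] by (auto simp: antichain_def maximals_def)

lemma antichain_subset: "antichain A \<Longrightarrow> B \<subseteq> A \<Longrightarrow> antichain B"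
  by (auto simp: antichain_def)

lemma finite_antichain: "antichain A \<Longrightarrow> finite A"
  unfolding antichain_def using finite_subset[OF _ finite_P] by blast

lemma finite_antichains: "finite {A. antichain A}"
  by (rule finite_subset[of _ "Pow P"]) (auto simp: antichain_def finite_P)

text \<open>If \<open>x\<close> in \<open>A\<close> lies below \<open>y\<close> and \<open>y\<close>
  lies below some \<open>z\<close> in \<open>A\<close>, then \<open>x = z\<close> in the antichain,
  and antisymmetry gives \<open>x = y\<close>.\<close>

lemma maximals_downset:
  assumes "antichain A"
  shows "maximals (downset A) = A"
proof
  show "maximals (downset A) \<subseteq> A"
    using assms le_refl by (fastforce simp: maximals_def downset_def antichain_def)
  show "A \<subseteq> maximals (downset A)"
  proof
    fix x assume x: "x \<in> A"
    have "x = y" if "y \<in> downset A" "(x, y) \<in> r" for y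
    proof -
      obtain z where z: "z \<in> A" "(y, z) \<in> r" using \<open>y \<in> downset A\<close> by (auto simp: downset_def)
      with that x assms have "x = z" using le_trans by (auto simp: antichain_def)
      with z that show ?thesis using le_antisym by blast
    qed
    moreover have "x \<in> downset A" using x assms le_refl by (auto simp: downset_def antichain_def)
    ultimately show "x \<in> maximals (downset A)" by (auto simp: maximals_def)
  qed
qed

text \<open>By finiteness every element of \<open>J\<close> lies below a maximal one: climbing from
  a non-maximal element strictly shrinks the set of elements of \<open>J\<close> above it.\<close>

lemma downset_maximals:
  assumes J: "J \<in> ideals"
  shows "downset (maximals J) = J"
proof
  show "downset (maximals J) \<subseteq> J"
    using ideal_down[OF J] by (auto simp: downset_def maximals_def)
  have "\<exists>x\<in>maximals J. (y, x) \<in> r" if y: "y \<in> J" for y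
    using y
  proof (induction "card {z \<in> J. (y, z) \<in> r}" arbitrary: y rule: less_induct)
    case less
    have yP: "y \<in> P" using less.prems ideal_subset[OF J] by auto
    show ?case
    proof (cases "y \<in> maximals J")
      case True
      then show ?thesis using le_refl yP by blast
    next
      case False
      then obtain z where z: "z \<in> J" "(y, z) \<in> r" "y \<noteq> z"
        using less.prems by (auto simp: maximals_def)
      have "{w \<in> J. (z, w) \<in> r} \<subset> {w \<in> J. (y, w) \<in> r}"
        using z le_trans le_antisym less.prems le_refl[OF yP] by blast
      then have "card {w \<in> J. (z, w) \<in> r} < card {w \<in> J. (y, w) \<in> r}"
        using finite_subset[OF ideal_subset[OF J] finite_P] by (intro psubset_card_mono) auto
      from less.hyps[OF this z(1)] show ?thesis using z(2) le_trans by blast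
    qed
  qed
  then show "J \<subseteq> downset (maximals J)"
    using ideal_subset[OF J] by (auto simp: downset_def)
qed

section \<open>Boolean intervals and antichain differences\<close>

text \<open>A maximal element of \<open>J\<close> lies below no other element of \<open>J\<close>,
  so removing it cannot break downward closure.\<close>

lemma ideal_Diff_maximals:
  assumes "J \<in> ideals" and "S \<subseteq> maximals J"
  shows "J - S \<in> ideals"
proof -
  have "y \<in> J - S" if x: "x \<in> J - S" and y: "y \<in> P" and yx: "(y, x) \<in> r" for x y
  proof -
    have "y \<in> J" using ideal_down[OF assms(1) _ yx y] x by simp
    moreover have "y \<notin> S" using assms(2) x yx unfolding maximals_def by blast
    ultimately show ?thesis by simp
  qed
  moreover have "J - S \<subseteq> P" using ideal_subset[OF assms(1)] by blast
  ultimately show ?thesis unfolding poset_ideals_def by blast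
qed

text \<open>An element of \<open>J\<close> above some \<open>x\<close> outside \<open>I\<close> is
  itself outside \<open>I\<close>, since \<open>I\<close> is closed downwards; the antichain
  condition then makes it equal to \<open>x\<close>.\<close>

lemma Diff_subset_maximals:
  assumes I: "I \<in> ideals" and J: "J \<in> ideals" and ac: "antichain (J - I)"
  shows "J - I \<subseteq> maximals J"
proof
  fix x assume x: "x \<in> J - I"
  have "x = y" if "y \<in> J" "(x, y) \<in> r" for y
  proof -
    have "y \<notin> I" using ideal_down[OF I _ that(2)] x ideal_subset[OF J] by blast
    then show ?thesis using ac x that unfolding antichain_def by blast
  qed
  then show "x \<in> maximals J" using x unfolding maximals_def by blast
qed

text \<open>Adding any subset of \<open>J - I\<close> to \<open>I\<close> gives an ideal, so the
  interval is a copy of \<open>Pow (J - I)\<close>; an enumeration \<open>g\<close> of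
  \<open>J - I\<close> carries it to the standard Boolean lattice.\<close>

lemma boolean_interval_if_antichain:
  assumes I: "I \<in> ideals" and J: "J \<in> ideals" and "I \<subseteq> J" and ac: "antichain (J - I)"
  shows "order_isomorphic (interval_in ideals I J) (boolean_lattice (card (J - I)))"
proof -
  let ?S = "J - I"
  obtain g where g: "bij_betw g ?S {1..card ?S}"
    using finite_same_card_bij[of ?S "{1..card ?S}"] finite_antichain[OF ac] by auto
  have interval: "I \<union> T \<in> interval_in ideals I J" if "T \<subseteq> ?S" for T
  proof -
    \<comment> \<open>Seen from the top, \<open>I \<union> T\<close> arises from \<open>J\<close> by
      deleting maximal elements, and is therefore an ideal.\<close>
    have "I \<union> T = J - (?S - T)" using that assms(3) by auto
    moreover have "J - (?S - T) \<in> ideals"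
      using ideal_Diff_maximals[OF J] Diff_subset_maximals[OF I J ac] by blast
    ultimately show ?thesis using that assms(3) by (auto simp: interval_in_def)
  qed
  have "bij_betw (\<lambda>M. M - I) (interval_in ideals I J) (Pow ?S)"
    by (rule bij_betw_byWitness[where f' = "\<lambda>T. I \<union> T"])
      (use interval in \<open>auto simp: interval_in_def\<close>)
  moreover have "bij_betw ((`) g) (Pow ?S) (boolean_lattice (card ?S))"
    using bij_betw_Pow[OF g] by (simp add: boolean_lattice_def)
  ultimately have "bij_betw ((`) g \<circ> (\<lambda>M. M - I)) (interval_in ideals I J)
      (boolean_lattice (card ?S))"
    by (rule bij_betw_trans)
  moreover have "M \<subseteq> N \<longleftrightarrow> ((`) g \<circ> (\<lambda>M. M - I)) M \<subseteq> ((`) g \<circ> (\<lambda>M. M - I)) N"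
    if "M \<in> interval_in ideals I J" "N \<in> interval_in ideals I J" for M N
  proof -
    have "inj_on g ?S" "M - I \<subseteq> ?S" "N - I \<subseteq> ?S"
      using that g by (auto simp: bij_betw_def interval_in_def)
    then have "g ` (M - I) \<subseteq> g ` (N - I) \<longleftrightarrow> M - I \<subseteq> N - I"
      unfolding inj_on_def by blast
    then show ?thesis using that by (auto simp: interval_in_def)
  qed
  ultimately show ?thesis unfolding order_isomorphic_def by (intro exI conjI ballI)
qed

text \<open>A Boolean lattice is complemented; if \<open>x < y\<close> in \<open>J - I\<close>, the ideal generated by \<open>I\<close> and \<open>x\<close>
  has no complement in \<open>[I, J]\<close>.\<close>

lemma antichain_if_boolean_interval:
  assumes I: "I \<in> ideals" and J: "J \<in> ideals" and "I \<subseteq> J"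
    and iso: "order_isomorphic (interval_in ideals I J) (boolean_lattice i)"
  shows "antichain (J - I)"
proof -
  let ?L = "interval_in ideals I J"
  obtain f where f: "bij_betw f ?L (Pow {1..i})"
    and mono: "\<And>M N. M \<in> ?L \<Longrightarrow> N \<in> ?L \<Longrightarrow> M \<subseteq> N \<longleftrightarrow> f M \<subseteq> f N"
    using iso by (auto simp: order_isomorphic_def boolean_lattice_def)
  have bounds: "I \<in> ?L" "J \<in> ?L" using assms(1-3) by (auto simp: interval_in_def)
  have "x = y" if x: "x \<in> J - I" and y: "y \<in> J - I" and xy: "(x, y) \<in> r" for x y
  proof (rule ccontr)
    assume "x \<noteq> y"
    let ?M = "I \<union> downset {x}"
    have xP: "x \<in> P" using x ideal_subset[OF J] by auto
    have M: "?M \<in> ?L"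
      using assms(3) x ideal_down[OF J] ideal_Un[OF I ideal_downset[of "{x}"]]
      by (auto simp: interval_in_def downset_def)
    have xM: "x \<in> ?M" using le_refl[OF xP] xP by (auto simp: downset_def)
    have yM: "y \<notin> ?M" using y xy \<open>x \<noteq> y\<close> le_antisym by (auto simp: downset_def)
    \<comment> \<open>\<open>N\<close> is the complement of \<open>?M\<close>, pulled back along
      \<open>f\<close> from the set complement in \<open>{1..i}\<close>.\<close>
    have "{1..i} - f ?M \<in> f ` ?L" using f by (auto simp: bij_betw_def)
    then obtain N where N: "N \<in> ?L" and fN: "f N = {1..i} - f ?M" by auto
    have meet: "?M \<inter> N \<in> ?L" and join: "?M \<union> N \<in> ?L"
      using M N ideal_Int ideal_Un by (auto simp: interval_in_def)
    have "f (?M \<inter> N) \<subseteq> f ?M" "f (?M \<inter> N) \<subseteq> f N"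
      using mono[OF meet M] mono[OF meet N] by auto
    \<comment> \<open>The left side is contained in two disjoint sets, hence empty. So the value of
      \<open>f I\<close> need not be computed, and dually for \<open>f J\<close> below.\<close>
    then have "f (?M \<inter> N) \<subseteq> f I" using fN by auto
    then have disj: "?M \<inter> N \<subseteq> I" using mono[OF meet bounds(1)] by simp
    have "f ?M \<subseteq> f (?M \<union> N)" "f N \<subseteq> f (?M \<union> N)"
      using mono[OF M join] mono[OF N join] by auto
    then have "{1..i} \<subseteq> f (?M \<union> N)" using fN by auto
    moreover have "f J \<subseteq> {1..i}" using f bounds(2) by (auto simp: bij_betw_def)
    ultimately have "J \<subseteq> ?M \<union> N" using mono[OF bounds(2) join] by auto
    \<comment> \<open>The join forces \<open>y\<close> into \<open>N\<close>, downward closure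
      brings \<open>x\<close> along, and then \<open>x\<close> lies in the meet although it is not
      in \<open>I\<close>.\<close>
    then have "y \<in> N" using y yM by auto
    then have "x \<in> N" using ideal_down[OF _ _ xy xP] N by (auto simp: interval_in_def)
    then show False using disj xM x by auto
  qed
  then show ?thesis using ideal_subset[OF J] by (auto simp: antichain_def)
qed

lemma boolean_interval_iff:
  assumes "I \<in> ideals" and "J \<in> ideals" and "I \<subseteq> J"
  shows "order_isomorphic (interval_in ideals I J) (boolean_lattice i) \<longleftrightarrow>
    antichain (J - I) \<and> card (J - I) = i"
proof
  assume iso: "order_isomorphic (interval_in ideals I J) (boolean_lattice i)"
  have ac: "antichain (J - I)"
    by (rule antichain_if_boolean_interval[OF assms iso])
  have "card (interval_in ideals I J) = 2 ^ k"
    if "order_isomorphic (interval_in ideals I J) (boolean_lattice k)" for k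
    using that
    by (auto simp: order_isomorphic_def boolean_lattice_def card_Pow dest: bij_betw_same_card)
  \<comment> \<open>The cardinality of the interval determines the rank, since it is a power of 2 in
    both descriptions.\<close>
  from this[OF iso] this[OF boolean_interval_if_antichain[OF assms ac]]
  have "(2::nat) ^ i = 2 ^ card (J - I)" by simp
  then show "antichain (J - I) \<and> card (J - I) = i" using ac by simp
next
  assume "antichain (J - I) \<and> card (J - I) = i"
  then show "order_isomorphic (interval_in ideals I J) (boolean_lattice i)"
    using boolean_interval_if_antichain[OF assms] by auto
qed

section \<open>Enumeration of Boolean intervals by antichains\<close>

text \<open>In a pair \<open>(A, S)\<close>, \<open>A\<close> is the set of maximal elements of the
  top ideal, and \<open>S\<close> consists of those deleted to reach the bottom ideal.\<close>

lemma bij_betw_boolean_intervals: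
  "bij_betw (\<lambda>(A, S). interval_in ideals (downset A - S) (downset A))
    (SIGMA A:{A. antichain A}. {S. S \<subseteq> A \<and> card S = i}) (boolean_intervals ideals i)"
  (is "bij_betw ?h ?X ?Y")
proof -
  have pair: "downset A - S \<in> ideals" "S \<subseteq> downset A" if "antichain A" "S \<subseteq> A" for A S
    using that ideal_Diff_maximals[OF ideal_downset[of A], of S] maximals_downset[OF that(1)]
    by (auto simp: maximals_def)
  have "inj_on ?h ?X"
  proof (rule inj_onI; clarify)
    fix A S B T
    assume A: "antichain A" "S \<subseteq> A" and B: "antichain B" "T \<subseteq> B"
      and eq: "interval_in ideals (downset A - S) (downset A) =
        interval_in ideals (downset B - T) (downset B)"
    \<comment> \<open>Intervals are bare sets here, so the endpoints must be recovered: each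
      interval contains its own, and equality of the sets bounds them by each other.\<close>
    have "{downset A, downset A - S} \<subseteq> interval_in ideals (downset A - S) (downset A)"
      "{downset B, downset B - T} \<subseteq> interval_in ideals (downset B - T) (downset B)"
      using pair(1)[OF A] pair(1)[OF B] ideal_downset by (auto simp: interval_in_def)
    then have "{downset A, downset A - S} \<subseteq> interval_in ideals (downset B - T) (downset B)"
      "{downset B, downset B - T} \<subseteq> interval_in ideals (downset A - S) (downset A)"
      using eq by auto
    then have J: "downset A = downset B" and I: "downset A - S = downset B - T"
      by (auto simp: interval_in_def)
    have "A = B" using J maximals_downset A(1) B(1) by metis
    moreover have "S = T" using I J pair(2)[OF A] pair(2)[OF B] by blast
    ultimately show "A = B \<and> S = T" ..
  qed
  moreover have "?h ` ?X \<subseteq> ?Y"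
  proof clarify
    fix A S assume A: "antichain A" "S \<subseteq> A" and i: "i = card S"
    have "downset A - (downset A - S) = S" using pair(2)[OF A] by auto
    then have "order_isomorphic (interval_in ideals (downset A - S) (downset A))
        (boolean_lattice (card S))"
      using boolean_interval_iff[OF pair(1)[OF A] ideal_downset, where i = "card S"]
        antichain_subset[OF A] by auto
    then show "interval_in ideals (downset A - S) (downset A) \<in> boolean_intervals ideals (card S)"
      using pair(1)[OF A] ideal_downset unfolding boolean_intervals_def by blast
  qed
  moreover have "?Y \<subseteq> ?h ` ?X"
  proof
    fix K assume "K \<in> ?Y"
    then obtain I J where K: "K = interval_in ideals I J"
      and IJ: "I \<in> ideals" "J \<in> ideals" "I \<subseteq> J"
      and "order_isomorphic (interval_in ideals I J) (boolean_lattice i)"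
      by (auto simp: boolean_intervals_def)
    then have ac: "antichain (J - I)" "card (J - I) = i" using boolean_interval_iff by auto
    have "K = ?h (maximals J, J - I)"
      using K IJ(3) downset_maximals[OF IJ(2)] by (simp add: double_diff)
    moreover have "(maximals J, J - I) \<in> ?X"
      using antichain_maximals[OF IJ(2)] Diff_subset_maximals[OF IJ(1,2) ac(1)] ac(2) by auto
    ultimately show "K \<in> ?h ` ?X" by (rule image_eqI)
  qed
  ultimately show ?thesis by (auto simp: bij_betw_def)
qed

lemma num_boolean_intervals_eq:
  "num_boolean_intervals ideals i = (\<Sum>A | antichain A. card A choose i)"
proof -
  have "num_boolean_intervals ideals i =
      card (SIGMA A:{A. antichain A}. {S. S \<subseteq> A \<and> card S = i})"
    using bij_betw_same_card[OF bij_betw_boolean_intervals] by (simp add: num_boolean_intervals_def)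
  also have "\<dots> = (\<Sum>A | antichain A. card {S. S \<subseteq> A \<and> card S = i})"
    using finite_antichains finite_antichain by (intro card_SigmaI) auto
  also have "\<dots> = (\<Sum>A | antichain A. card A choose i)"
    using finite_antichain by (intro sum.cong) (auto simp: n_subsets)
  finally show ?thesis .
qed

text \<open>No antichain exceeds \<open>card P\<close>, so the series is a finite sum and the
  summations can be exchanged; vanishing binomials then cut the inner range to
  \<open>card A\<close>.\<close>

lemma alternating_sum_num_boolean_intervals:
  fixes f :: "nat \<Rightarrow> real"
  shows "(\<Sum>i. (- 1) ^ i * real (num_boolean_intervals ideals i) * f i) =
    (\<Sum>A | antichain A. \<Sum>i\<le>card A. (- 1) ^ i * real (card A choose i) * f i)"
proof -
  have card_le: "card A \<le> card P" if "antichain A" for A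
    using that finite_P by (auto simp: antichain_def intro: card_mono)
  have "(\<Sum>i. (- 1) ^ i * real (num_boolean_intervals ideals i) * f i) =
      (\<Sum>i\<le>card P. (- 1) ^ i * real (num_boolean_intervals ideals i) * f i)"
  proof (rule suminf_finite)
    fix i assume "i \<notin> {..card P}"
    then have "card A choose i = 0" if "antichain A" for A
      using card_le[OF that] by (intro binomial_eq_0) auto
    then have "num_boolean_intervals ideals i = 0"
      unfolding num_boolean_intervals_eq by (intro sum.neutral) blast
    then show "(- 1) ^ i * real (num_boolean_intervals ideals i) * f i = 0"
      by simp
  qed simp
  also have "\<dots> = (\<Sum>i\<le>card P. \<Sum>A | antichain A. (- 1) ^ i * real (card A choose i) * f i)"
    by (simp add: num_boolean_intervals_eq sum_distrib_left sum_distrib_right)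
  also have "\<dots> = (\<Sum>A | antichain A. \<Sum>i\<le>card P. (- 1) ^ i * real (card A choose i) * f i)"
    by (rule sum.swap)
  also have "\<dots> = (\<Sum>A | antichain A. \<Sum>i\<le>card A. (- 1) ^ i * real (card A choose i) * f i)"
    using card_le by (intro sum.cong refl sum.mono_neutral_right) (auto simp: binomial_eq_0)
  finally show ?thesis .
qed

section \<open>Antichains with at most two elements\<close>

lemma card_antichains_0: "card {A. antichain A \<and> card A = 0} = 1"
proof -
  have "{A. antichain A \<and> card A = 0} = {{}}"
  proof (intro equalityI subsetI)
    fix A assume "A \<in> {A. antichain A \<and> card A = 0}"
    then show "A \<in> {{}}" using finite_antichain[of A] by simp
  qed (simp add: antichain_def)
  then show ?thesis by simp
qed

lemma card_antichains_1: "card {A. antichain A \<and> card A = 1} = card P"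
proof -
  have "{A. antichain A \<and> card A = 1} = (\<lambda>x. {x}) ` P"
    by (auto simp: antichain_def card_1_singleton_iff)
  then show ?thesis by (simp add: card_image)
qed

text \<open>\<open>P \<times> P\<close> splits into comparable and incomparable pairs. The relations
  \<open>?le\<close> and \<open>?ge\<close> have equal size and meet in the diagonal, while each
  two-element antichain accounts for two ordered incomparable pairs.\<close>

lemma card_antichains_2:
  "2 * card {(p, q). p \<in> P \<and> q \<in> P \<and> (p, q) \<in> r} +
    2 * card {A. antichain A \<and> card A = 2} = (card P)\<^sup>2 + card P"
proof -
  let ?le = "{(p, q). p \<in> P \<and> q \<in> P \<and> (p, q) \<in> r}"
  let ?ge = "{(p, q). p \<in> P \<and> q \<in> P \<and> (q, p) \<in> r}"
  let ?inc = "{(p, q). p \<in> P \<and> q \<in> P \<and> (p, q) \<notin> r \<and> (q, p) \<notin> r}"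
  let ?A2 = "{A. antichain A \<and> card A = 2}"
  have fin: "finite ?le" "finite ?ge" "finite ?inc"
    by (rule finite_subset[of _ "P \<times> P"]; auto simp: finite_P)+
  have "?ge = prod.swap ` ?le" by auto
  then have ge: "card ?ge = card ?le" by (simp add: card_image)
  have "?le \<inter> ?ge = (\<lambda>x. (x, x)) ` P" using le_refl le_antisym by auto
  then have eq: "card (?le \<inter> ?ge) = card P" by (simp add: card_image inj_on_def)
  \<comment> \<open>The two orderings of a two-element set; over \<open>?A2\<close> these blocks
    partition \<open>?inc\<close>.\<close>
  define pairs :: "'a set \<Rightarrow> ('a \<times> 'a) set"
    where "pairs A = {(p, q). {p, q} = A \<and> p \<noteq> q}" for A
  have "?inc = (\<Union>A\<in>?A2. pairs A)"
  proof (intro equalityI subsetI)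
    fix z assume "z \<in> ?inc"
    then obtain p q where z: "z = (p, q)" "p \<in> P" "q \<in> P" "(p, q) \<notin> r" "(q, p) \<notin> r"
      by auto
    then have "p \<noteq> q" using le_refl by auto
    then have "{p, q} \<in> ?A2" "z \<in> pairs {p, q}" using z by (auto simp: antichain_def pairs_def)
    then show "z \<in> (\<Union>A\<in>?A2. pairs A)" by blast
  next
    fix z assume "z \<in> (\<Union>A\<in>?A2. pairs A)"
    then show "z \<in> ?inc" by (auto simp: antichain_def pairs_def)
  qed
  moreover have pairs: "finite (pairs A) \<and> card (pairs A) = 2" if A: "A \<in> ?A2" for A
  proof -
    obtain x y where "A = {x, y}" "x \<noteq> y" using A by (auto simp: card_2_iff)
    then have "pairs A = {(x, y), (y, x)}"
      by (auto simp: pairs_def doubleton_eq_iff)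
    then show ?thesis using \<open>x \<noteq> y\<close> by simp
  qed
  moreover have "card (\<Union>A\<in>?A2. pairs A) = (\<Sum>A\<in>?A2. card (pairs A))"
  proof (rule card_UN_disjoint)
    show "finite ?A2" using finite_antichains by simp
    show "\<forall>A\<in>?A2. finite (pairs A)" using pairs by blast
    show "\<forall>A\<in>?A2. \<forall>B\<in>?A2. A \<noteq> B \<longrightarrow> pairs A \<inter> pairs B = {}"
      by (auto simp: pairs_def)
  qed
  ultimately have inc: "card ?inc = 2 * card ?A2" by simp
  have "P \<times> P = (?le \<union> ?ge) \<union> ?inc" by auto
  then have "card P * card P = card ((?le \<union> ?ge) \<union> ?inc)"
    by (metis card_cartesian_product)
  also have "\<dots> = card (?le \<union> ?ge) + card ?inc"
    using fin by (intro card_Un_disjoint) auto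
  finally have "(card P)\<^sup>2 = card (?le \<union> ?ge) + 2 * card ?A2"
    by (simp add: inc power2_eq_square)
  moreover have "card ?le + card ?ge = card (?le \<union> ?ge) + card (?le \<inter> ?ge)"
    using fin by (intro card_Un_Int) auto
  ultimately show ?thesis using ge eq by simp
qed

end

section \<open>Evaluation of the alternating sum\<close>

theorem corollary2p5:
  fixes P :: "'a set" and r :: "'a rel" and n :: nat
  assumes "finite P"
    and "partial_order_on P r"
    and "card P = n"
  shows "real (card {(p, q). p \<in> P \<and> q \<in> P \<and> (p, q) \<in> r}) =
    1 / 2 * (\<Sum>i. (- 1) ^ (i + 1) * real (num_boolean_intervals (poset_ideals P r) i) * (real n + real i)\<^sup>2)"
proof -
  interpret finite_poset P r using assms by unfold_locales
  let ?b = "\<lambda>i. (- 1) ^ i * real (num_boolean_intervals ideals i) * (real n + real i)\<^sup>2"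
  let ?a = "\<lambda>k. card {A. antichain A \<and> card A = k}"
  let ?g = "\<lambda>c k (A::'a set). if card A = k then c else (0::real)"
  have count: "(\<Sum>A | antichain A. ?g c k A) = real (?a k) * c" for c k
    using finite_antichains by (simp add: sum.If_cases Collect_conj_eq)
  have "(\<Sum>i. ?b i) = (\<Sum>A | antichain A.
      if card A = 0 then (real n)\<^sup>2 else if card A = 1 then - (2 * real n + 1)
      else if card A = 2 then 2 else 0)"
    by (simp only: alternating_sum_num_boolean_intervals alternating_binomial_sum_square)
  \<comment> \<open>Splitting the case distinction into three indicator terms lets
    \<open>count\<close> turn each into a number of antichains times a constant.\<close>
  also have "\<dots> = (\<Sum>A | antichain A. ?g ((real n)\<^sup>2) 0 A + ?g (- (2 * real n + 1)) 1 A + ?g 2 2 A)"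
    by (rule sum.cong) auto
  also have "\<dots> = (real n)\<^sup>2 - real n * (2 * real n + 1) + 2 * real (?a 2)"
    unfolding sum.distrib count card_antichains_0 card_antichains_1 assms(3)
    by (simp add: algebra_simps)
  finally have sum: "(\<Sum>i. ?b i) = 2 * real (?a 2) - (real n)\<^sup>2 - real n"
    by (simp add: power2_eq_square algebra_simps)
  have "(\<Sum>i. (- 1) ^ (i + 1) * real (num_boolean_intervals ideals i) * (real n + real i)\<^sup>2) =
      (\<Sum>i. - ?b i)"
    by simp
  \<comment> \<open>The exponent \<open>i + 1\<close> contributes a global sign; moving it out of
    the series requires summability.\<close>
  also have "\<dots> = - (\<Sum>i. ?b i)"
    by (rule suminf_minus) (rule summable_num_boolean_intervals[OF finite_ideals])
  finally have "(\<Sum>i. (- 1) ^ (i + 1) * real (num_boolean_intervals ideals i) *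
      (real n + real i)\<^sup>2) = (real n)\<^sup>2 + real n - 2 * real (?a 2)"
    by (simp add: sum)
  moreover have "2 * real (card {(p, q). p \<in> P \<and> q \<in> P \<and> (p, q) \<in> r}) + 2 * real (?a 2) =
      (real n)\<^sup>2 + real n"
    using arg_cong[OF card_antichains_2, of real] by (simp add: assms(3))
  ultimately show ?thesis by simp
qed

end
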